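(* Let $Q$ be a Funk function of a spray $\mathbf{G}$ and put $\widetilde Q(x,y):=\frac12\big[Q(x,y)+Q(x,-y)\big]$. Then $Q$ satisfies $$P:=\frac{Q_{;0}}{2Q}=\frac12Q,\qquad \frac{P^2-P_{;0}}{Q^2}=-\frac14 .$$ If $\mathbf{G}$ is strictly reversible, then $\widetilde Q$ is a Hamel function of $\mathbf{G}$ and satisfies $$\widetilde P:=\frac{\widetilde Q_{;0}}{2\widetilde Q}=\frac12\big[Q(x,y)-Q(x,-y)\big],\qquad \frac{\widetilde P^2-\widetilde P_{;0}}{\widetilde Q^2}=-1 .$$
   Context: A spray on a manifold $M$ is a smooth vector field on a conical region of $TM\setminus\{0\}$ (an open set closed under $y\mapsto\lambda y$, $\lambda>0$), locally $\mathbf{G}=y^i\frac{\partial}{\partial x^i}-2G^i\frac{\partial}{\partial y^i}$ with $G^i$ positively homogeneous of degree two in $y$. Put $\partial_k=\partial/\partial x^k$, $\dot\partial_k=\partial/\partial y^k$, $G^r_i=\dot\partial_iG^r$, $G^r_{ij}=\dot\partial_j\dot\partial_iG^r$, $\delta_i=\partial_i-G^r_i\dot\partial_r$. For a function $f$: $f_{.i}=\dot\partial_if$, $f_{;i}=\delta_if$, $f_{;0}=f_{;i}y^i$, $f_{.i;j}=\delta_jf_{.i}-f_{.r}G^r_{ij}$, $f_{.i;0}=f_{.i;j}y^j$. A Hamel function (resp. Funk function) of $\mathbf{G}$ is a function $P$, positively homogeneous of degree one in $y$, with $P_{;k}=P_{.k;0}$ (resp. $P_{;k}=PP_{.k}$).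 $\mathbf{G}$ is strictly reversible if $G^i(x,y)=G^i(x,-y)$. Formulas involving values at $-y$ are considered where both $y$ and $-y$ lie in the domain, and formulas with $Q$ (resp. $\widetilde Q$) in a denominator are considered where it is nonzero. *)

theory Defs
  imports "HOL-Analysis.Analysis"
begin

section \<open>Smooth maps between Euclidean spaces\<close>

text \<open>Both notions are meant for open domains.\<close>

primrec Ck_on :: "nat \<Rightarrow> 'a::real_normed_vector set \<Rightarrow> ('a \<Rightarrow> 'b::real_normed_vector) \<Rightarrow> bool" where
  "Ck_on 0 S f \<longleftrightarrow> continuous_on S f"
| "Ck_on (Suc k) S f \<longleftrightarrow>
     (\<forall>x\<in>S. f differentiable (at x)) \<and> (\<forall>v. Ck_on k S (\<lambda>x. frechet_derivative f (at x) v))"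

definition smooth_on :: "'a::real_normed_vector set \<Rightarrow> ('a \<Rightarrow> 'b::real_normed_vector) \<Rightarrow> bool" where
  "smooth_on S f \<longleftrightarrow> (\<forall>k. Ck_on k S f)"


section \<open>Manifolds, tangent bundles, vector fields\<close>

type_synonym ('a, 'e) chart = "'a set \<times> ('a \<Rightarrow> 'e)"

definition chart_inv :: "('a, 'e) chart \<Rightarrow> 'e \<Rightarrow> 'a" where
  "chart_inv c = inv_into (fst c) (snd c)"

definition chart_image :: "('a, 'e) chart \<Rightarrow> 'a set \<Rightarrow> 'e set" where
  "chart_image c A = snd c ` (A \<inter> fst c)"

definition transition :: "('a, 'e) chart \<Rightarrow> ('a, 'e) chart \<Rightarrow> 'e \<Rightarrow> 'e" where
  "transition c c' = snd c' \<circ> chart_inv c"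

definition local_rep :: "('a, 'e) chart \<Rightarrow> ('a \<Rightarrow> 'b) \<Rightarrow> 'e \<Rightarrow> 'b" where
  "local_rep c f = f \<circ> chart_inv c"

text \<open>The atlas is not required to be maximal.\<close>

definition smooth_manifold :: "'a topology \<Rightarrow> ('a, 'e::euclidean_space) chart set \<Rightarrow> bool" where
  "smooth_manifold X \<C> \<longleftrightarrow>
     Hausdorff_space X \<and> second_countable X \<and> topspace X = (\<Union>c\<in>\<C>. fst c) \<and>
     (\<forall>c\<in>\<C>. openin X (fst c) \<and> open (snd c ` fst c) \<and>
        homeomorphic_map (subtopology X (fst c)) (top_of_set (snd c ` fst c)) (snd c)) \<and>
     (\<forall>c\<in>\<C>. \<forall>c'\<in>\<C>. smooth_on (chart_image c (fst c')) (transition c c'))"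

text \<open>A tangent vector at \<open>p\<close> is the family of its components in all charts around \<open>p\<close>,
  any two of which are related by the derivative of the transition map. The value at charts not
  containing \<open>p\<close> is fixed to be \<open>0\<close>, so that equality of tangent vectors is equality of functions.\<close>

definition tangent_space :: "('a, 'e::euclidean_space) chart set \<Rightarrow> 'a \<Rightarrow> (('a, 'e) chart \<Rightarrow> 'e) set" where
  "tangent_space \<C> p = {\<xi>.
     (\<forall>c. \<not> (c \<in> \<C> \<and> p \<in> fst c) \<longrightarrow> \<xi> c = 0) \<and>
     (\<forall>c\<in>\<C>. \<forall>c'\<in>\<C>. p \<in> fst c \<and> p \<in> fst c' \<longrightarrow>
        \<xi> c' = frechet_derivative (transition c c') (at (snd c p)) (\<xi> c))}"

type_synonym ('a, 'e) tangent = "'a \<times> (('a, 'e) chart \<Rightarrow> 'e)"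

definition tangent_bundle :: "('a, 'e::euclidean_space) chart set \<Rightarrow> ('a, 'e) tangent set" where
  "tangent_bundle \<C> = {(p, \<xi>). p \<in> (\<Union>c\<in>\<C>. fst c) \<and> \<xi> \<in> tangent_space \<C> p}"

definition tangent_scale :: "real \<Rightarrow> ('a, 'e::euclidean_space) tangent \<Rightarrow> ('a, 'e) tangent" where
  "tangent_scale t u = (fst u, \<lambda>c. t *\<^sub>R snd u c)"

text \<open>The chart \<open>(x, y)\<close> of the tangent bundle induced by a chart \<open>x\<close> of the manifold.\<close>

definition tangent_chart ::
  "('a, 'e::euclidean_space) chart set \<Rightarrow> ('a, 'e) chart \<Rightarrow> (('a, 'e) tangent, 'e \<times> 'e) chart" where
  "tangent_chart \<C> c = ({u \<in> tangent_bundle \<C>. fst u \<in> fst c}, \<lambda>u. (snd c (fst u), snd u c))"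

definition tangent_atlas ::
  "('a, 'e::euclidean_space) chart set \<Rightarrow> (('a, 'e) tangent, 'e \<times> 'e) chart set" where
  "tangent_atlas \<C> = tangent_chart \<C> ` \<C>"

definition atlas_open :: "('a, 'e::euclidean_space) chart set \<Rightarrow> 'a set \<Rightarrow> bool" where
  "atlas_open \<C> A \<longleftrightarrow> A \<subseteq> (\<Union>c\<in>\<C>. fst c) \<and> (\<forall>c\<in>\<C>. open (chart_image c A))"

definition smooth_fun :: "('a, 'e::euclidean_space) chart set \<Rightarrow> 'a set \<Rightarrow> ('a \<Rightarrow> real) \<Rightarrow> bool" where
  "smooth_fun \<C> A f \<longleftrightarrow> (\<forall>c\<in>\<C>. smooth_on (chart_image c A) (local_rep c f))"

definition smooth_vector_field ::
  "('a, 'e::euclidean_space) chart set \<Rightarrow> 'a set \<Rightarrow> ('a \<Rightarrow> ('a, 'e) chart \<Rightarrow> 'e) \<Rightarrow> bool" where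
  "smooth_vector_field \<C> A V \<longleftrightarrow>
     (\<forall>p\<in>A. V p \<in> tangent_space \<C> p) \<and>
     (\<forall>c\<in>\<C>. smooth_on (chart_image c A) (local_rep c (\<lambda>p. V p c)))"

definition conical_region ::
  "('a, 'e::euclidean_space) chart set \<Rightarrow> ('a, 'e) tangent set \<Rightarrow> bool" where
  "conical_region \<C> A \<longleftrightarrow>
     A \<subseteq> tangent_bundle \<C> \<and> (\<forall>u\<in>A. snd u \<noteq> (\<lambda>_. 0)) \<and>
     atlas_open (tangent_atlas \<C>) A \<and>
     (\<forall>u\<in>A. \<forall>t>0. tangent_scale t u \<in> A)"


section \<open>Sprays\<close>

text \<open>A vector field on (part of) the tangent bundle is a family of components with respect to the
  charts of the tangent bundle.\<close>

type_synonym ('a, 'e) bundle_field = "('a, 'e) tangent \<Rightarrow> (('a, 'e) tangent, 'e \<times> 'e) chart \<Rightarrow> 'e \<times> 'e"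

text \<open>The \<open>\<partial>/\<partial>y\<close>-component of a spray is \<open>- 2 G\<close>.\<close>

definition spray_coeff ::
  "('a, 'e::euclidean_space) chart set \<Rightarrow> ('a, 'e) bundle_field \<Rightarrow> ('a, 'e) chart \<Rightarrow> 'e \<times> 'e \<Rightarrow> 'e" where
  "spray_coeff \<C> \<G> c =
     local_rep (tangent_chart \<C> c) (\<lambda>u. (- 1 / 2) *\<^sub>R snd (\<G> u (tangent_chart \<C> c)))"

definition spray ::
  "('a, 'e::euclidean_space) chart set \<Rightarrow> ('a, 'e) tangent set \<Rightarrow> ('a, 'e) bundle_field \<Rightarrow> bool" where
  "spray \<C> A \<G> \<longleftrightarrow>
     conical_region \<C> A \<and> smooth_vector_field (tangent_atlas \<C>) A \<G> \<and>
     (\<forall>c\<in>\<C>. \<forall>(x, y)\<in>chart_image (tangent_chart \<C> c) A.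
        fst (local_rep (tangent_chart \<C> c) \<G> (x, y) (tangent_chart \<C> c)) = y \<and>
        (\<forall>t>0. spray_coeff \<C> \<G> c (x, t *\<^sub>R y) = t\<^sup>2 *\<^sub>R spray_coeff \<C> \<G> c (x, y)))"

definition strictly_reversible ::
  "('a, 'e::euclidean_space) chart set \<Rightarrow> ('a, 'e) tangent set \<Rightarrow> ('a, 'e) bundle_field \<Rightarrow> bool" where
  "strictly_reversible \<C> A \<G> \<longleftrightarrow>
     (\<forall>c\<in>\<C>. \<forall>x y. (x, y) \<in> chart_image (tangent_chart \<C> c) A \<longrightarrow>
        (x, - y) \<in> chart_image (tangent_chart \<C> c) A \<longrightarrow>
        spray_coeff \<C> \<G> c (x, y) = spray_coeff \<C> \<G> c (x, - y))"


section \<open>Horizontal and vertical derivatives in induced coordinates\<close>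

type_synonym 'n coord = "(real^'n) \<times> (real^'n)"

definition dx :: "'n::finite \<Rightarrow> ('n coord \<Rightarrow> real) \<Rightarrow> 'n coord \<Rightarrow> real" where
  "dx k f z = frechet_derivative f (at z) (axis k 1, 0)"

definition dy :: "'n::finite \<Rightarrow> ('n coord \<Rightarrow> real) \<Rightarrow> 'n coord \<Rightarrow> real" where
  "dy k f z = frechet_derivative f (at z) (0, axis k 1)"

definition conn :: "('n::finite coord \<Rightarrow> real^'n) \<Rightarrow> 'n \<Rightarrow> 'n \<Rightarrow> 'n coord \<Rightarrow> real" where
  "conn G r i = dy i (\<lambda>z. G z $ r)"

definition berwald :: "('n::finite coord \<Rightarrow> real^'n) \<Rightarrow> 'n \<Rightarrow> 'n \<Rightarrow> 'n \<Rightarrow> 'n coord \<Rightarrow> real" where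
  "berwald G r i j = dy j (dy i (\<lambda>z. G z $ r))"

text \<open>\<open>hor G i f\<close> is \<open>f\<^sub>;\<^sub>i = \<delta>\<^sub>i f\<close>, \<open>hor0 G f\<close> is \<open>f\<^sub>;\<^sub>0\<close>, \<open>ver_hor G i j f\<close> is \<open>f\<^sub>.\<^sub>i\<^sub>;\<^sub>j\<close> and
  \<open>ver_hor0 G i f\<close> is \<open>f\<^sub>.\<^sub>i\<^sub>;\<^sub>0\<close>.\<close>

definition hor :: "('n::finite coord \<Rightarrow> real^'n) \<Rightarrow> 'n \<Rightarrow> ('n coord \<Rightarrow> real) \<Rightarrow> 'n coord \<Rightarrow> real" where
  "hor G i f z = dx i f z - (\<Sum>r\<in>UNIV. conn G r i z * dy r f z)"

definition hor0 :: "('n::finite coord \<Rightarrow> real^'n) \<Rightarrow> ('n coord \<Rightarrow> real) \<Rightarrow> 'n coord \<Rightarrow> real" where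
  "hor0 G f z = (\<Sum>i\<in>UNIV. hor G i f z * snd z $ i)"

definition ver_hor :: "('n::finite coord \<Rightarrow> real^'n) \<Rightarrow> 'n \<Rightarrow> 'n \<Rightarrow> ('n coord \<Rightarrow> real) \<Rightarrow> 'n coord \<Rightarrow> real" where
  "ver_hor G i j f z = hor G j (dy i f) z - (\<Sum>r\<in>UNIV. dy r f z * berwald G r i j z)"

definition ver_hor0 :: "('n::finite coord \<Rightarrow> real^'n) \<Rightarrow> 'n \<Rightarrow> ('n coord \<Rightarrow> real) \<Rightarrow> 'n coord \<Rightarrow> real" where
  "ver_hor0 G i f z = (\<Sum>j\<in>UNIV. ver_hor G i j f z * snd z $ j)"


section \<open>Hamel and Funk functions\<close>

text \<open>The functions live on a conical region \<open>D\<close> on which the spray is defined.\<close>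

definition homogeneous1 :: "('a, 'e::euclidean_space) tangent set \<Rightarrow> (('a, 'e) tangent \<Rightarrow> real) \<Rightarrow> bool" where
  "homogeneous1 D P \<longleftrightarrow> (\<forall>u\<in>D. \<forall>t>0. P (tangent_scale t u) = t * P u)"

definition hamel_function ::
  "('a, real^'n::finite) chart set \<Rightarrow> ('a, real^'n) bundle_field \<Rightarrow> ('a, real^'n) tangent set \<Rightarrow>
     (('a, real^'n) tangent \<Rightarrow> real) \<Rightarrow> bool" where
  "hamel_function \<C> \<G> D P \<longleftrightarrow>
     conical_region \<C> D \<and> smooth_fun (tangent_atlas \<C>) D P \<and> homogeneous1 D P \<and>
     (\<forall>c\<in>\<C>. \<forall>z\<in>chart_image (tangent_chart \<C> c) D. \<forall>k.
        hor (spray_coeff \<C> \<G> c) k (local_rep (tangent_chart \<C> c) P) z =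
        ver_hor0 (spray_coeff \<C> \<G> c) k (local_rep (tangent_chart \<C> c) P) z)"

definition funk_function ::
  "('a, real^'n::finite) chart set \<Rightarrow> ('a, real^'n) bundle_field \<Rightarrow> ('a, real^'n) tangent set \<Rightarrow>
     (('a, real^'n) tangent \<Rightarrow> real) \<Rightarrow> bool" where
  "funk_function \<C> \<G> D P \<longleftrightarrow>
     conical_region \<C> D \<and> smooth_fun (tangent_atlas \<C>) D P \<and> homogeneous1 D P \<and>
     (\<forall>c\<in>\<C>. \<forall>z\<in>chart_image (tangent_chart \<C> c) D. \<forall>k.
        hor (spray_coeff \<C> \<G> c) k (local_rep (tangent_chart \<C> c) P) z =
        local_rep (tangent_chart \<C> c) P z * dy k (local_rep (tangent_chart \<C> c) P) z)"

definition sym_region :: "('a, 'e::euclidean_space) tangent set \<Rightarrow> ('a, 'e) tangent set" where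
  "sym_region D = {u \<in> D. tangent_scale (- 1) u \<in> D}"

definition symmetrization :: "(('a, 'e::euclidean_space) tangent \<Rightarrow> real) \<Rightarrow> ('a, 'e) tangent \<Rightarrow> real" where
  "symmetrization Q u = (1 / 2) * (Q u + Q (tangent_scale (- 1) u))"

end

theory Submission
  imports Defs
begin

text \<open>Euler's identity turns the Funk equation \<open>q\<^sub>;\<^sub>k = q q\<^sub>.\<^sub>k\<close> into \<open>q\<^sub>;\<^sub>0 = q\<^sup>2\<close>. The whole
  proposition is about differences: if \<open>q\<close> and \<open>p\<close> are both Funk and \<open>f = a (q - p)\<close>, then
  \<open>f\<^sub>;\<^sub>0 = a (q\<^sup>2 - p\<^sup>2)\<close>, so \<open>P = f\<^sub>;\<^sub>0 / (2 f)\<close> is \<open>(q + p) / 2\<close> where \<open>f \<noteq> 0\<close>, whence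
  \<open>P\<^sub>;\<^sub>0 = (q\<^sup>2 + p\<^sup>2) / 2\<close> and \<open>P\<^sup>2 - P\<^sub>;\<^sub>0 = - (q - p)\<^sup>2 / 4\<close>; this is
  \<open>scaled_difference_funk_curvature\<close>. The identities for \<open>Q\<close> are the case \<open>p = 0\<close>, \<open>a = 1\<close>. If the
  spray is strictly reversible, then \<open>p(x, y) = - q(x, - y)\<close> is again Funk (\<open>funk_on_reflect\<close>): the
  reflection \<open>y \<mapsto> - y\<close> preserves horizontal derivatives and changes the sign of vertical ones.
  The symmetrization is then the case \<open>a = 1/2\<close>.

  For the Hamel equation, differentiate the contraction \<open>f\<^sub>;\<^sub>0 = f\<^sub>;\<^sub>j y\<^sup>j\<close>: since mixed partial
  derivatives commute, the vertical derivative of \<open>f\<^sub>;\<^sub>0\<close> in direction \<open>i\<close> is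
  \<open>f\<^sub>;\<^sub>i + f\<^sub>.\<^sub>i\<^sub>;\<^sub>0\<close> (\<open>dy_hor0\<close>). So \<open>f\<close> is Hamel iff that derivative is \<open>2 f\<^sub>;\<^sub>i\<close>, and for
  \<open>f = a (q - p)\<close> both sides equal \<open>2 a (q q\<^sub>.\<^sub>i - p p\<^sub>.\<^sub>i)\<close>.

  All of this happens in one induced chart of the tangent bundle. What remains is to see that the
  local representatives are well defined there, that in such a chart scaling acts on the fibre
  coordinate only, and that the points of the symmetrized region are those whose coordinates
  \<open>(x, y)\<close> and \<open>(x, - y)\<close> both lie in the image of the region.\<close>

section \<open>Differentiation of \<open>C\<^sup>k\<close> maps on open sets\<close>

text \<open>The maps have the same derivatives at \<open>z\<close>, so that even where there is none both sides are the
  same arbitrary value.\<close>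

lemma frechet_derivative_cong_open:
  assumes "open S" "z \<in> S" "\<And>w. w \<in> S \<Longrightarrow> f w = g w"
  shows "frechet_derivative f (at z) = frechet_derivative g (at z)"
proof -
  have "(f has_derivative f') (at z) \<longleftrightarrow> (g has_derivative f') (at z)" for f'
    using assms has_derivative_transform_within_open[of f f' z UNIV S g]
      has_derivative_transform_within_open[of g f' z UNIV S f] by auto
  then show ?thesis
    by (simp add: frechet_derivative_def)
qed

lemma Ck_on_cong_open:
  assumes "open S" "\<And>w. w \<in> S \<Longrightarrow> f w = g w" "Ck_on k S f"
  shows "Ck_on k S g"
  using assms(2,3)
proof (induction k arbitrary: f g)
  case 0
  then show ?case
    using continuous_on_cong by fastforce
next
  case (Suc k)
  have "g differentiable at x" if "x \<in> S" for x
  proof -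
    have "(f has_derivative frechet_derivative f (at x)) (at x)"
      using Suc.prems that by (simp add: frechet_derivative_works)
    then have "(g has_derivative frechet_derivative f (at x)) (at x)"
      by (rule has_derivative_transform_within_open[OF _ assms(1) that Suc.prems(1)])
    then show ?thesis
      unfolding differentiable_def by blast
  qed
  moreover have "Ck_on k S (\<lambda>x. frechet_derivative g (at x) v)" for v
    using Suc.IH[of "\<lambda>x. frechet_derivative f (at x) v"] Suc.prems
      frechet_derivative_cong_open[OF assms(1), of _ f g] by auto
  ultimately show ?case
    by simp
qed

lemma Ck_on_subset: "Ck_on k S f \<Longrightarrow> T \<subseteq> S \<Longrightarrow> Ck_on k T f"
  by (induction k arbitrary: f) (auto intro: continuous_on_subset)

lemma Ck_on_add:
  assumes "open S" "Ck_on k S f" "Ck_on k S g"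
  shows "Ck_on k S (\<lambda>x. f x + g x)"
  using assms(2,3)
proof (induction k arbitrary: f g)
  case 0
  then show ?case by (auto intro: continuous_intros)
next
  case (Suc k)
  have D: "frechet_derivative (\<lambda>x. f x + g x) (at x) =
      (\<lambda>v. frechet_derivative f (at x) v + frechet_derivative g (at x) v)" if "x \<in> S" for x
    using Suc.prems that
    by (intro frechet_derivative_at[symmetric] has_derivative_add)
      (auto simp: frechet_derivative_works)
  have "Ck_on k S (\<lambda>x. frechet_derivative (\<lambda>x. f x + g x) (at x) v)" for v
    by (rule Ck_on_cong_open[OF assms(1) _ Suc.IH[of "\<lambda>x. frechet_derivative f (at x) v"
      "\<lambda>x. frechet_derivative g (at x) v"]]) (use Suc.prems D in auto)
  then show ?case
    using Suc.prems by auto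
qed

lemma Ck_on_bounded_linear:
  assumes "open S" "bounded_linear L" "Ck_on k S f"
  shows "Ck_on k S (\<lambda>x. L (f x))"
  using assms(3)
proof (induction k arbitrary: f)
  case 0
  then show ?case
    using assms(2) by (auto intro: bounded_linear.continuous_on)
next
  case (Suc k)
  have D': "((\<lambda>x. L (f x)) has_derivative (\<lambda>v. L (frechet_derivative f (at x) v))) (at x)"
    if "x \<in> S" for x
    using Suc.prems that
    by (intro bounded_linear.has_derivative[OF assms(2)]) (auto simp: frechet_derivative_works)
  have "Ck_on k S (\<lambda>x. frechet_derivative (\<lambda>x. L (f x)) (at x) v)" for v
    by (rule Ck_on_cong_open[OF assms(1) _ Suc.IH[of "\<lambda>x. frechet_derivative f (at x) v"]])
      (use Suc.prems frechet_derivative_at[OF D'] in \<open>auto dest: fun_cong\<close>)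
  then show ?case
    using D' by (auto simp: differentiable_def)
qed

lemma Ck_on_precompose_bounded_linear:
  assumes "open S" "bounded_linear L" "L ` S \<subseteq> T" "Ck_on k T f"
  shows "Ck_on k S (\<lambda>x. f (L x))"
  using assms(4)
proof (induction k arbitrary: f)
  case 0
  then show ?case
    using assms(2,3) linear_continuous_on[OF assms(2)]
    by (auto intro: continuous_on_compose2)
next
  case (Suc k)
  have D': "((\<lambda>x. f (L x)) has_derivative (\<lambda>v. frechet_derivative f (at (L x)) (L v))) (at x)"
    if "x \<in> S" for x
    using Suc.prems that assms(3)
    by (intro has_derivative_compose[OF bounded_linear_imp_has_derivative[OF assms(2)]])
     (auto simp: frechet_derivative_works)
  have "Ck_on k S (\<lambda>x. frechet_derivative (\<lambda>x. f (L x)) (at x) v)" for v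
    by (rule Ck_on_cong_open[OF assms(1) _ Suc.IH[of "\<lambda>x. frechet_derivative f (at x) (L v)"]])
      (use Suc.prems frechet_derivative_at[OF D'] in \<open>auto dest: fun_cong\<close>)
  then show ?case
    using D' by (auto simp: differentiable_def)
qed

text \<open>Reduces directional derivatives to derivatives of a real variable, so that the mean value
  theorem applies.\<close>

lemma has_real_derivative_along_line:
  assumes "f differentiable at (z + s *\<^sub>R u)"
  shows "((\<lambda>s. f (z + s *\<^sub>R u)) has_real_derivative frechet_derivative f (at (z + s *\<^sub>R u)) u) (at s)"
proof -
  have "((\<lambda>s. f (z + s *\<^sub>R u)) has_derivative
      (\<lambda>h. frechet_derivative f (at (z + s *\<^sub>R u)) (h *\<^sub>R u))) (at s)"
    using assms unfolding frechet_derivative_works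
    by (intro has_derivative_compose[of "\<lambda>s. z + s *\<^sub>R u" "\<lambda>h. h *\<^sub>R u" s UNIV f])
      (auto intro!: derivative_eq_intros)
  then show ?thesis
    using linear_frechet_derivative[OF assms]
    by (simp add: has_field_derivative_def linear_cmul mult_commute_abs)
qed

text \<open>The mean value theorem in direction \<open>u\<close>, applied to \<open>s \<mapsto> f(z + s u + t v) - f(z + s u)\<close>,
  and then in direction \<open>v\<close>. The left-hand side is symmetric in \<open>u\<close> and \<open>v\<close>, which forces the
  two mixed derivatives to agree in the limit.\<close>

lemma second_difference_eq_mixed_derivative:
  fixes f :: "'a::real_normed_vector \<Rightarrow> real"
  assumes f: "Ck_on 2 S f" and "0 < t"
    and S: "\<And>a b. \<lbrakk>0 \<le> a; a \<le> t; 0 \<le> b; b \<le> t\<rbrakk> \<Longrightarrow> z + a *\<^sub>R u + b *\<^sub>R v \<in> S"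
  obtains a b where "0 < a" "a < t" "0 < b" "b < t"
    "f (z + t *\<^sub>R u + t *\<^sub>R v) - f (z + t *\<^sub>R u) - f (z + t *\<^sub>R v) + f z =
     t\<^sup>2 * frechet_derivative (\<lambda>w. frechet_derivative f (at w) u) (at (z + a *\<^sub>R u + b *\<^sub>R v)) v"
proof -
  let ?fu = "\<lambda>w. frechet_derivative f (at w) u"
  have f1: "f differentiable at w" and f2: "?fu differentiable at w" if "w \<in> S" for w
    using f that by (auto simp: numeral_2_eq_2)
  have 1: "((\<lambda>s. f (z + s *\<^sub>R u + t *\<^sub>R v) - f (z + s *\<^sub>R u)) has_real_derivative
      ?fu (z + s *\<^sub>R u + t *\<^sub>R v) - ?fu (z + s *\<^sub>R u)) (at s)" if "0 \<le> s" "s \<le> t" for s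
  proof (rule DERIV_diff)
    show "((\<lambda>s. f (z + s *\<^sub>R u + t *\<^sub>R v)) has_real_derivative ?fu (z + s *\<^sub>R u + t *\<^sub>R v)) (at s)"
      using has_real_derivative_along_line[of f "z + t *\<^sub>R v" s u] f1 S[of s t] that \<open>0 < t\<close>
      by (simp add: algebra_simps)
    show "((\<lambda>s. f (z + s *\<^sub>R u)) has_real_derivative ?fu (z + s *\<^sub>R u)) (at s)"
      using has_real_derivative_along_line[of f z s u] f1 S[of s 0] that \<open>0 < t\<close> by simp
  qed
  obtain a where a: "0 < a" "a < t"
    "f (z + t *\<^sub>R u + t *\<^sub>R v) - f (z + t *\<^sub>R u) - (f (z + 0 *\<^sub>R u + t *\<^sub>R v) - f (z + 0 *\<^sub>R u)) =
      (t - 0) * (?fu (z + a *\<^sub>R u + t *\<^sub>R v) - ?fu (z + a *\<^sub>R u))"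
    using MVT2[OF \<open>0 < t\<close> 1] by blast
  have 2: "((\<lambda>s. ?fu (z + a *\<^sub>R u + s *\<^sub>R v)) has_real_derivative
      frechet_derivative ?fu (at (z + a *\<^sub>R u + s *\<^sub>R v)) v) (at s)" if "0 \<le> s" "s \<le> t" for s
    using has_real_derivative_along_line[of ?fu "z + a *\<^sub>R u" s v] f2 S[of a s] that a by simp
  obtain b where b: "0 < b" "b < t"
    "?fu (z + a *\<^sub>R u + t *\<^sub>R v) - ?fu (z + a *\<^sub>R u + 0 *\<^sub>R v) =
      (t - 0) * frechet_derivative ?fu (at (z + a *\<^sub>R u + b *\<^sub>R v)) v"
    using MVT2[OF \<open>0 < t\<close> 2] by blast
  show thesis
    by (rule that[OF a(1,2) b(1,2)]) (use a(3) b(3) in \<open>simp add: power2_eq_square\<close>)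
qed

text \<open>Schwarz's theorem: by the mean value form of the second difference, \<open>D\<^sub>v D\<^sub>u f\<close> and
  \<open>D\<^sub>u D\<^sub>v f\<close> agree at suitable pairs of points arbitrarily close to \<open>z\<close>, and both are continuous.\<close>

lemma mixed_derivatives_commute:
  fixes f :: "'a::real_normed_vector \<Rightarrow> real"
  assumes "open S" "z \<in> S" and f: "Ck_on 2 S f"
  shows "frechet_derivative (\<lambda>w. frechet_derivative f (at w) u) (at z) v =
         frechet_derivative (\<lambda>w. frechet_derivative f (at w) v) (at z) u"
proof (rule ccontr)
  define A where "A \<equiv> \<lambda>w. frechet_derivative (\<lambda>w. frechet_derivative f (at w) u) (at w) v"
  define B where "B \<equiv> \<lambda>w. frechet_derivative (\<lambda>w. frechet_derivative f (at w) v) (at w) u"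
  assume "\<not> ?thesis"
  then have pos: "0 < dist (A z) (B z) / 2"
    by (simp add: A_def B_def)
  have "isCont A z" "isCont B z"
    using f assms(1,2) by (auto simp: A_def B_def numeral_2_eq_2 continuous_on_eq_continuous_at)
  then obtain d1 d2 where d: "0 < d1" "0 < d2"
    "\<And>w. dist w z < d1 \<Longrightarrow> dist (A w) (A z) < dist (A z) (B z) / 2"
    "\<And>w. dist w z < d2 \<Longrightarrow> dist (B w) (B z) < dist (A z) (B z) / 2"
    using pos unfolding continuous_at_eps_delta by metis
  obtain d3 where d3: "0 < d3" "ball z d3 \<subseteq> S"
    using assms(1,2) openE by blast
  \<comment> \<open>The side length \<open>t\<close> keeps the parallelogram spanned by \<open>t u\<close> and \<open>t v\<close> within distance
    \<open>d / 2\<close> of \<open>z\<close>; the summand \<open>1\<close> in \<open>m\<close> covers \<open>u = v = 0\<close>.\<close>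
  define d where "d = min d1 (min d2 d3)"
  define m where "m = norm u + norm v + 1"
  define t where "t = d / (2 * m)"
  have "0 < d"
    using d(1,2) d3 by (simp add: d_def)
  have "0 < m"
    unfolding m_def by (smt (verit) norm_ge_zero)
  have "0 < t"
    using \<open>0 < d\<close> \<open>0 < m\<close> by (simp add: t_def)
  have near: "dist (z + a *\<^sub>R u + b *\<^sub>R v) z < d" if "0 \<le> a" "a \<le> t" "0 \<le> b" "b \<le> t" for a b
  proof -
    have "dist (z + a *\<^sub>R u + b *\<^sub>R v) z \<le> a * norm u + b * norm v"
      using norm_triangle_ineq[of "a *\<^sub>R u" "b *\<^sub>R v"] that by (simp add: dist_norm add.assoc)
    also have "\<dots> \<le> t * norm u + t * norm v"
      using that by (intro add_mono mult_right_mono) auto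
    also have "\<dots> \<le> t * m"
      using \<open>0 < t\<close> by (simp add: m_def algebra_simps)
    also have "\<dots> = d / 2"
      using \<open>0 < m\<close> by (simp add: t_def)
    finally show ?thesis
      using \<open>0 < d\<close> by simp
  qed
  have inS: "z + a *\<^sub>R u + b *\<^sub>R v \<in> S" if "0 \<le> a" "a \<le> t" "0 \<le> b" "b \<le> t" for a b
    using near[OF that] d3 by (auto simp: d_def dist_commute)
  obtain a b where ab: "0 < a" "a < t" "0 < b" "b < t"
    "f (z + t *\<^sub>R u + t *\<^sub>R v) - f (z + t *\<^sub>R u) - f (z + t *\<^sub>R v) + f z =
     t\<^sup>2 * A (z + a *\<^sub>R u + b *\<^sub>R v)"
    using second_difference_eq_mixed_derivative[OF f \<open>0 < t\<close> inS] unfolding A_def by blast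
  have inS': "z + a *\<^sub>R v + b *\<^sub>R u \<in> S" if "0 \<le> a" "a \<le> t" "0 \<le> b" "b \<le> t" for a b
    using inS[of b a] that by (simp add: algebra_simps)
  obtain a' b' where ab': "0 < a'" "a' < t" "0 < b'" "b' < t"
    "f (z + t *\<^sub>R v + t *\<^sub>R u) - f (z + t *\<^sub>R v) - f (z + t *\<^sub>R u) + f z =
     t\<^sup>2 * B (z + a' *\<^sub>R v + b' *\<^sub>R u)"
    using second_difference_eq_mixed_derivative[OF f \<open>0 < t\<close> inS'] unfolding B_def by blast
  have "t\<^sup>2 * A (z + a *\<^sub>R u + b *\<^sub>R v) = t\<^sup>2 * B (z + b' *\<^sub>R u + a' *\<^sub>R v)"
    using ab(5) ab'(5) by (simp add: algebra_simps)
  then have "A (z + a *\<^sub>R u + b *\<^sub>R v) = B (z + b' *\<^sub>R u + a' *\<^sub>R v)"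
    using \<open>0 < t\<close> by simp
  moreover have "dist (A (z + a *\<^sub>R u + b *\<^sub>R v)) (A z) < dist (A z) (B z) / 2"
    using near[of a b] ab by (intro d(3)) (simp add: d_def)
  moreover have "dist (B (z + b' *\<^sub>R u + a' *\<^sub>R v)) (B z) < dist (A z) (B z) / 2"
    using near[of b' a'] ab' by (intro d(4)) (simp add: d_def)
  ultimately show False
    using dist_triangle_half_r[of "A (z + a *\<^sub>R u + b *\<^sub>R v)" "A z" "dist (A z) (B z)" "B z"]
    by (simp add: dist_real_def)
qed

section \<open>Horizontal and vertical derivatives\<close>

lemma dx_cong_open:
  "\<lbrakk>open S; z \<in> S; \<And>w. w \<in> S \<Longrightarrow> f w = g w\<rbrakk> \<Longrightarrow> dx k f z = dx k g z"
  and dy_cong_open: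
  "\<lbrakk>open S; z \<in> S; \<And>w. w \<in> S \<Longrightarrow> f w = g w\<rbrakk> \<Longrightarrow> dy k f z = dy k g z"
  unfolding dx_def dy_def using frechet_derivative_cong_open[of S z f g] by simp_all

lemma hor_cong_open:
  assumes "open S" "z \<in> S" "\<And>w. w \<in> S \<Longrightarrow> f w = g w"
  shows "hor G k f z = hor G k g z"
  using dx_cong_open[OF assms] dy_cong_open[OF assms] by (simp add: hor_def)

lemma hor0_cong_open:
  assumes "open S" "z \<in> S" "\<And>w. w \<in> S \<Longrightarrow> f w = g w"
  shows "hor0 G f z = hor0 G g z"
  using hor_cong_open[OF assms] by (simp add: hor0_def)

lemma
  assumes "f differentiable at z" "g differentiable at z"
  shows dx_lincomb: "dx k (\<lambda>w. a * f w + b * g w) z = a * dx k f z + b * dx k g z"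
    and dy_lincomb: "dy k (\<lambda>w. a * f w + b * g w) z = a * dy k f z + b * dy k g z"
proof -
  have "((\<lambda>w. a * f w + b * g w) has_derivative
      (\<lambda>v. a * frechet_derivative f (at z) v + b * frechet_derivative g (at z) v)) (at z)"
    using assms unfolding frechet_derivative_works by (auto intro!: derivative_eq_intros)
  from frechet_derivative_at[OF this, symmetric]
  show "dx k (\<lambda>w. a * f w + b * g w) z = a * dx k f z + b * dx k g z"
    "dy k (\<lambda>w. a * f w + b * g w) z = a * dy k f z + b * dy k g z"
    by (simp_all add: dx_def dy_def)
qed

lemma hor_lincomb:
  assumes "f differentiable at z" "g differentiable at z"
  shows "hor G k (\<lambda>w. a * f w + b * g w) z = a * hor G k f z + b * hor G k g z"
  by (simp add: hor_def dx_lincomb[OF assms] dy_lincomb[OF assms] algebra_simps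
      sum.distrib sum_distrib_left)

lemma hor0_lincomb:
  assumes "f differentiable at z" "g differentiable at z"
  shows "hor0 G (\<lambda>w. a * f w + b * g w) z = a * hor0 G f z + b * hor0 G g z"
  by (simp add: hor0_def hor_lincomb[OF assms] algebra_simps sum.distrib sum_distrib_left)

lemma dy_power2:
  assumes "f differentiable at z"
  shows "dy k (\<lambda>w. (f w)\<^sup>2) z = 2 * f z * dy k f z"
proof -
  have "((\<lambda>w. (f w)\<^sup>2) has_derivative (\<lambda>v. 2 * f z * frechet_derivative f (at z) v)) (at z)"
    using assms unfolding frechet_derivative_works by (auto intro!: derivative_eq_intros)
  from frechet_derivative_at[OF this, symmetric] show ?thesis
    by (simp add: dy_def)
qed

text \<open>The derivative of \<open>s \<mapsto> f(x, (1 + s) y)\<close> at \<open>0\<close>, computed by the chain rule and from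
  homogeneity.\<close>

lemma euler_identity:
  fixes f :: "'n::finite coord \<Rightarrow> real"
  assumes "f differentiable at (x, y)" "\<And>t. 0 < t \<Longrightarrow> f (x, t *\<^sub>R y) = t * f (x, y)"
  shows "(\<Sum>i\<in>UNIV. dy i f (x, y) * y $ i) = f (x, y)"
proof -
  let ?D = "frechet_derivative f (at (x, y))"
  have lin: "linear ?D"
    using assms(1) by (rule linear_frechet_derivative)
  have "(0, y) = (\<Sum>i\<in>UNIV. y $ i *\<^sub>R (0 :: real^'n, axis i (1::real)))"
    by (simp add: prod_eq_iff fst_sum snd_sum basis_expansion[of y, unfolded scalar_mult_eq_scaleR])
  then have "?D (0, y) = ?D (\<Sum>i\<in>UNIV. y $ i *\<^sub>R (0, axis i 1))"
    by (rule arg_cong)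
  also have "\<dots> = (\<Sum>i\<in>UNIV. dy i f (x, y) * y $ i)"
    unfolding linear_sum[OF lin] linear_cmul[OF lin] dy_def by (simp add: mult.commute)
  finally have sum: "?D (0, y) = (\<Sum>i\<in>UNIV. dy i f (x, y) * y $ i)" .
  have 1: "((\<lambda>s. f ((x, y) + s *\<^sub>R (0, y))) has_real_derivative ?D (0, y)) (at 0)"
    using has_real_derivative_along_line[of f "(x, y)" 0 "(0, y)"] assms(1) by simp
  have 2: "((\<lambda>s. f ((x, y) + s *\<^sub>R (0, y))) has_real_derivative f (x, y)) (at 0)"
  \<comment> \<open>Homogeneity holds for positive factors only, hence \<open>s > - 1\<close>.\<close>
  proof (rule has_field_derivative_transform_within_open[of "\<lambda>s. (1 + s) * f (x, y)" _ _ "{-1<..}"])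
    show "(1 + s) * f (x, y) = f ((x, y) + s *\<^sub>R (0, y))" if "s \<in> {-1<..}" for s
      using assms(2)[of "1 + s"] that by (simp add: algebra_simps)
  qed (auto intro!: derivative_eq_intros)
  show ?thesis
    using DERIV_unique[OF 1 2] unfolding sum .
qed

lemma has_derivative_frechet_derivative:
  "f differentiable at z \<Longrightarrow> (f has_derivative frechet_derivative f (at z)) (at z)"
  by (simp add: frechet_derivative_works)

text \<open>The product rule on \<open>f\<^sub>;\<^sub>j y\<^sup>j\<close>: differentiating \<open>y\<^sup>j\<close> leaves \<open>f\<^sub>;\<^sub>i\<close>. In the other term the
  derivative of \<open>f\<^sub>;\<^sub>j\<close> falls on \<open>f\<close>, where it commutes with the partial derivatives in \<open>\<delta>\<^sub>j\<close>, or on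
  the connection coefficients, where it produces exactly the Berwald correction in \<open>f\<^sub>.\<^sub>i\<^sub>;\<^sub>j\<close>. The
  Hamel equation thus becomes a statement about \<open>f\<^sub>;\<^sub>0\<close>.\<close>

lemma dy_hor0:
  fixes f :: "'n::finite coord \<Rightarrow> real"
  assumes "open S" "z \<in> S" and f: "Ck_on 2 S f" and G: "\<And>r. Ck_on 2 S (\<lambda>w. G w $ r)"
  shows "dy i (hor0 G f) z = hor G i f z + ver_hor0 G i f z"
proof -
  let ?e = "(0, axis i 1) :: 'n coord"
  let ?F = "\<lambda>g. frechet_derivative g (at z)"
  have d: "dx k f differentiable at z" "dy k f differentiable at z" "conn G r k differentiable at z"
    for k r
    using f G assms(2) by (auto simp: numeral_2_eq_2 dx_def[abs_def] dy_def[abs_def] conn_def)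
  have hor_der: "(hor G k f has_derivative (\<lambda>v. ?F (dx k f) v
      - (\<Sum>r\<in>UNIV. conn G r k z * ?F (dy r f) v + ?F (conn G r k) v * dy r f z))) (at z)" for k
    unfolding hor_def[abs_def]
    by (intro has_derivative_diff has_derivative_sum has_derivative_mult
      has_derivative_frechet_derivative d)
  have y_der: "((\<lambda>w. snd w $ k) has_derivative (\<lambda>v. snd v $ k)) (at z)" for k
    by (auto intro!: derivative_eq_intros bounded_linear_imp_has_derivative
      bounded_linear_compose[OF bounded_linear_vec_nth bounded_linear_snd])
  have "(hor0 G f has_derivative (\<lambda>v. \<Sum>k\<in>UNIV. hor G k f z * snd v $ k + (?F (dx k f) v
      - (\<Sum>r\<in>UNIV. conn G r k z * ?F (dy r f) v + ?F (conn G r k) v * dy r f z)) * snd z $ k)) (at z)"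
    unfolding hor0_def[abs_def]
    by (intro has_derivative_sum has_derivative_mult hor_der y_der)
  from frechet_derivative_at[OF this, symmetric]
  have "dy i (hor0 G f) z = (\<Sum>k\<in>UNIV. hor G k f z * axis i 1 $ k + (?F (dx k f) ?e
      - (\<Sum>r\<in>UNIV. conn G r k z * ?F (dy r f) ?e + ?F (conn G r k) ?e * dy r f z)) * snd z $ k)"
    by (simp add: dy_def[of i "hor0 G f"])
  also have "\<dots> = (\<Sum>k\<in>UNIV. hor G k f z * axis i 1 $ k) + (\<Sum>k\<in>UNIV. ver_hor G i k f z * snd z $ k)"
  proof -
    \<comment> \<open>Schwarz, for \<open>f\<close> and for the components of \<open>G\<close>\<close>
    have "?F (dx k f) ?e = dx k (dy i f) z" "?F (dy r f) ?e = dy r (dy i f) z"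
      "?F (conn G r k) ?e = berwald G r i k z" for k r
      using mixed_derivatives_commute[OF assms(1,2) f] mixed_derivatives_commute[OF assms(1,2) G]
      by (simp_all add: dx_def[abs_def] dy_def[abs_def] conn_def berwald_def)
    then have "?F (dx k f) ?e - (\<Sum>r\<in>UNIV. conn G r k z * ?F (dy r f) ?e
        + ?F (conn G r k) ?e * dy r f z) = ver_hor G i k f z" for k
      by (simp add: ver_hor_def hor_def[of G _ "dy i f"] sum.distrib mult.commute)
    then show ?thesis
      by (simp add: sum.distrib)
  qed
  also have "(\<Sum>k\<in>UNIV. hor G k f z * axis i 1 $ k) = hor G i f z"
    by (simp add: axis_def if_distrib cong: if_cong)
  finally show ?thesis
    by (simp add: ver_hor0_def)
qed

section \<open>Differences of Funk functions\<close>

text \<open>Homogeneity is encoded as Euler's identity, so that the property is pointwise and passes to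
  subsets.\<close>

definition funk_on :: "('n::finite coord \<Rightarrow> real^'n) \<Rightarrow> 'n coord set \<Rightarrow> ('n coord \<Rightarrow> real) \<Rightarrow> bool" where
  "funk_on G S q \<longleftrightarrow> (\<forall>z\<in>S. q differentiable at z \<and>
     (\<Sum>i\<in>UNIV. dy i q z * snd z $ i) = q z \<and> (\<forall>k. hor G k q z = q z * dy k q z))"

lemma funk_on_zero: "funk_on G S (\<lambda>_. 0)"
  by (simp add: funk_on_def hor_def dx_def dy_def)

lemma hor0_funk:
  assumes "funk_on G S q" "z \<in> S"
  shows "hor0 G q z = (q z)\<^sup>2"
proof -
  have "hor0 G q z = q z * (\<Sum>i\<in>UNIV. dy i q z * snd z $ i)"
    unfolding hor0_def sum_distrib_left
    using assms by (intro sum.cong) (auto simp: funk_on_def)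
  also have "(\<Sum>i\<in>UNIV. dy i q z * snd z $ i) = q z"
    using assms by (simp add: funk_on_def)
  finally show ?thesis
    by (simp add: power2_eq_square)
qed

lemma hor0_scaled_difference_funk:
  assumes "open S" "z \<in> S" and q: "funk_on G S q" and p: "funk_on G S p"
    and f: "\<And>w. w \<in> S \<Longrightarrow> f w = a * (q w - p w)"
  shows "hor0 G f z = a * ((q z)\<^sup>2 - (p z)\<^sup>2)"
proof -
  have "hor0 G f z = hor0 G (\<lambda>w. a * q w + (- a) * p w) z"
    by (rule hor0_cong_open[OF assms(1,2)]) (simp add: f algebra_simps)
  also have "\<dots> = a * hor0 G q z + (- a) * hor0 G p z"
    using q p \<open>z \<in> S\<close> by (intro hor0_lincomb) (auto simp: funk_on_def)
  finally show ?thesis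
    using hor0_funk[OF q \<open>z \<in> S\<close>] hor0_funk[OF p \<open>z \<in> S\<close>] by (simp add: algebra_simps)
qed

text \<open>Since \<open>f\<^sub>;\<^sub>0 = a (q - p) (q + p) = f (q + p)\<close>, the function \<open>P\<close> is again a linear combination
  of Funk functions, whose \<open>P\<^sub>;\<^sub>0\<close> is known.\<close>

lemma scaled_difference_funk_curvature:
  fixes f :: "'n::finite coord \<Rightarrow> real"
  assumes "open S" "z \<in> S" and q: "funk_on G S q" and p: "funk_on G S p"
    and f: "\<And>w. w \<in> S \<Longrightarrow> f w = a * (q w - p w)" and "f z \<noteq> 0"
  defines "P \<equiv> \<lambda>w. hor0 G f w / (2 * f w)"
  shows "P z = (q z + p z) / 2" "(P z)\<^sup>2 - hor0 G P z = - ((q z - p z) / 2)\<^sup>2"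
proof -
  \<comment> \<open>To differentiate \<open>P\<close> at \<open>z\<close> its closed form must hold near \<open>z\<close>, but it may fail at zeros of
    \<open>f\<close> (where \<open>P\<close> is \<open>0\<close> by convention); these are removed here.\<close>
  define V where "V = {w \<in> S. q w - p w \<noteq> 0}"
  have diff: "q differentiable at w" "p differentiable at w" if "w \<in> S" for w
    using that q p by (auto simp: funk_on_def)
  have "continuous_on S (\<lambda>w. q w - p w)"
    using diff by (intro continuous_at_imp_continuous_on ballI continuous_diff)
      (auto intro: differentiable_imp_continuous_within)
  then have "open (S \<inter> (\<lambda>w. q w - p w) -` (- {0}))"
    by (rule continuous_open_preimage[OF _ \<open>open S\<close>]) auto
  also have "S \<inter> (\<lambda>w. q w - p w) -` (- {0}) = V"
    by (auto simp: V_def)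
  finally have "open V" .
  have "a \<noteq> 0" "z \<in> V"
    using \<open>z \<in> S\<close> \<open>f z \<noteq> 0\<close> f by (auto simp: V_def)
  have P: "P w = 1 / 2 * q w + 1 / 2 * p w" if "w \<in> V" for w
  proof -
    have "hor0 G f w = a * ((q w)\<^sup>2 - (p w)\<^sup>2)"
      using that hor0_scaled_difference_funk[OF assms(1) _ q p f] by (auto simp: V_def)
    also have "\<dots> = (2 * f w) * ((q w + p w) / 2)"
    proof -
      have "f w = a * (q w - p w)"
        using that f by (simp add: V_def)
      then show ?thesis
        by (simp only:) (simp add: power2_eq_square algebra_simps)
    qed
    finally have "hor0 G f w = (2 * f w) * ((q w + p w) / 2)" .
    moreover have "2 * f w \<noteq> 0"
      using that f \<open>a \<noteq> 0\<close> by (auto simp: V_def)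
    ultimately have "P w = (q w + p w) / 2"
      unfolding P_def by (simp only: nonzero_mult_div_cancel_left not_False_eq_True)
    then show ?thesis
      by simp
  qed
  then show Pz: "P z = (q z + p z) / 2"
    using \<open>z \<in> V\<close> by (simp add: field_simps)
  have "hor0 G P z = hor0 G (\<lambda>w. 1 / 2 * q w + 1 / 2 * p w) z"
    by (rule hor0_cong_open[OF \<open>open V\<close> \<open>z \<in> V\<close> P])
  also have "\<dots> = 1 / 2 * hor0 G q z + 1 / 2 * hor0 G p z"
    using diff \<open>z \<in> S\<close> by (intro hor0_lincomb)
  finally have "hor0 G P z = ((q z)\<^sup>2 + (p z)\<^sup>2) / 2"
    using hor0_funk[OF q \<open>z \<in> S\<close>] hor0_funk[OF p \<open>z \<in> S\<close>] by simp
  then show "(P z)\<^sup>2 - hor0 G P z = - ((q z - p z) / 2)\<^sup>2"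
    by (simp add: Pz power2_eq_square field_simps)
qed

text \<open>The vertical derivative of \<open>f\<^sub>;\<^sub>0 = a (q\<^sup>2 - p\<^sup>2)\<close> is \<open>2 a (q q\<^sub>.\<^sub>k - p p\<^sub>.\<^sub>k) = 2 f\<^sub>;\<^sub>k\<close> by the Funk
  equations, which by \<open>dy_hor0\<close> is the Hamel equation.\<close>

lemma scaled_difference_funk_is_hamel:
  fixes f :: "'n::finite coord \<Rightarrow> real"
  assumes "open S" "z \<in> S" and q: "funk_on G S q" and p: "funk_on G S p"
    and f: "\<And>w. w \<in> S \<Longrightarrow> f w = a * (q w - p w)"
    and "Ck_on 2 S f" "\<And>r. Ck_on 2 S (\<lambda>w. G w $ r)"
  shows "hor G k f z = ver_hor0 G k f z"
proof -
  have diff: "q differentiable at z" "p differentiable at z"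
    using \<open>z \<in> S\<close> q p by (auto simp: funk_on_def)
  have "dy k (hor0 G f) z = dy k (\<lambda>w. a * (q w)\<^sup>2 + (- a) * (p w)\<^sup>2) z"
    by (rule dy_cong_open[OF assms(1,2)])
      (simp add: hor0_scaled_difference_funk[OF assms(1) _ q p f] algebra_simps)
  also have "\<dots> = a * dy k (\<lambda>w. (q w)\<^sup>2) z + (- a) * dy k (\<lambda>w. (p w)\<^sup>2) z"
    using diff by (intro dy_lincomb differentiable_power)
  also have "\<dots> = 2 * (a * hor G k q z + (- a) * hor G k p z)"
    using q p \<open>z \<in> S\<close> by (simp add: dy_power2[OF diff(1)] dy_power2[OF diff(2)] funk_on_def)
  also have "\<dots> = 2 * hor G k (\<lambda>w. a * q w + (- a) * p w) z"
    by (simp only: hor_lincomb[OF diff])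
  also have "hor G k (\<lambda>w. a * q w + (- a) * p w) z = hor G k f z"
    by (rule hor_cong_open[OF assms(1,2)]) (simp add: f algebra_simps)
  finally show ?thesis
    using dy_hor0[OF assms(1,2,6,7), of k] by simp
qed

section \<open>Reflection of the fibres\<close>

definition reflect :: "'n::finite coord \<Rightarrow> 'n coord" where
  "reflect z = (fst z, - snd z)"

lemma reflect_Pair [simp]: "reflect (x, y) = (x, - y)"
  by (simp add: reflect_def)

lemma bounded_linear_reflect: "bounded_linear reflect"
  unfolding reflect_def[abs_def]
  by (intro bounded_linear_Pair bounded_linear_fst bounded_linear_minus bounded_linear_snd)

lemma
  assumes "f differentiable at (reflect z)"
  shows differentiable_reflect: "(\<lambda>w. f (reflect w)) differentiable at z"
    and dx_reflect: "dx k (\<lambda>w. f (reflect w)) z = dx k f (reflect z)"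
    and dy_reflect: "dy k (\<lambda>w. f (reflect w)) z = - dy k f (reflect z)"
proof -
  let ?D = "frechet_derivative f (at (reflect z))"
  have D: "((\<lambda>w. f (reflect w)) has_derivative (\<lambda>v. ?D (reflect v))) (at z)"
    using assms unfolding frechet_derivative_works
    by (rule has_derivative_compose[OF bounded_linear_imp_has_derivative[OF bounded_linear_reflect]])
  then show "(\<lambda>w. f (reflect w)) differentiable at z"
    by (auto simp: differentiable_def)
  have "?D (0, - axis k 1) = - ?D (0, axis k 1)"
    using linear_neg[OF linear_frechet_derivative[OF assms], of "(0, axis k 1)"] by simp
  then show "dx k (\<lambda>w. f (reflect w)) z = dx k f (reflect z)"
    "dy k (\<lambda>w. f (reflect w)) z = - dy k f (reflect z)"
    using frechet_derivative_at[OF D, symmetric] by (simp_all add: dx_def dy_def)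
qed

text \<open>Under \<open>y \<mapsto> - y\<close> vertical derivatives change sign. Since \<open>G\<close> is even, so do the connection
  coefficients \<open>G\<^sup>r\<^sub>k\<close>; the two signs cancel in \<open>\<delta>\<^sub>k\<close>. So \<open>q(x, - y)\<close> satisfies the Funk equation
  with the wrong sign on the right-hand side, and the outer minus corrects it.\<close>

lemma funk_on_reflect:
  fixes q :: "'n::finite coord \<Rightarrow> real"
  assumes "open S" and S: "\<And>w. w \<in> S \<Longrightarrow> reflect w \<in> S" and q: "funk_on G S q"
    and G: "\<And>w r. w \<in> S \<Longrightarrow> (\<lambda>w. G w $ r) differentiable at w"
    and even: "\<And>w. w \<in> S \<Longrightarrow> G (reflect w) = G w"
  shows "funk_on G S (\<lambda>w. - q (reflect w))"
  unfolding funk_on_def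
proof (intro ballI conjI allI)
  fix z k assume "z \<in> S"
  let ?p = "\<lambda>w. - q (reflect w)"
  have r: "reflect z \<in> S" and dq: "q differentiable at (reflect z)"
    using S q \<open>z \<in> S\<close> by (auto simp: funk_on_def)
  note diff = differentiable_reflect[OF dq]
  show "?p differentiable at z"
    using diff by (rule differentiable_minus)
  \<comment> \<open>Negation as a linear combination, so that linearity of the partial derivatives applies\<close>
  have neg: "?p = (\<lambda>w. (- 1) * q (reflect w) + 0 * q (reflect w))"
    by simp
  have dx: "dx i ?p z = - dx i q (reflect z)" and dy: "dy i ?p z = dy i q (reflect z)" for i
    unfolding neg dx_lincomb[OF diff diff] dy_lincomb[OF diff diff]
    by (simp_all add: dx_reflect[OF dq] dy_reflect[OF dq])
  have "(\<Sum>i\<in>UNIV. dy i q (reflect z) * snd (reflect z) $ i) = q (reflect z)"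
    using q r by (simp add: funk_on_def)
  then show "(\<Sum>i\<in>UNIV. dy i ?p z * snd z $ i) = ?p z"
    by (simp add: dy sum_negf reflect_def[of z])
  have "conn G i k z = - conn G i k (reflect z)" for i
  proof -
    have "conn G i k z = dy k (\<lambda>w. G (reflect w) $ i) z"
      unfolding conn_def by (rule dy_cong_open[OF \<open>open S\<close> \<open>z \<in> S\<close>]) (simp add: even)
    then show ?thesis
      by (simp add: dy_reflect[OF G[OF r]] conn_def)
  qed
  then have "hor G k ?p z = - hor G k q (reflect z)"
    by (simp add: hor_def dx dy sum_negf)
  then show "hor G k ?p z = ?p z * dy k ?p z"
    using q r by (simp add: funk_on_def dy)
qed

section \<open>Induced charts of the tangent bundle\<close>

lemma smooth_manifold_chart_inj:
  assumes "smooth_manifold X \<C>" "c \<in> \<C>"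
  shows "inj_on (snd c) (fst c)"
proof -
  have "fst c \<subseteq> topspace X"
    using assms openin_subset unfolding smooth_manifold_def by blast
  moreover have "homeomorphic_map (subtopology X (fst c)) (top_of_set (snd c ` fst c)) (snd c)"
    using assms unfolding smooth_manifold_def by blast
  ultimately show ?thesis
    using homeomorphic_imp_injective_map by (fastforce simp: Int_absorb1)
qed

text \<open>A tangent vector is determined by its component in one chart around its base point: the
  transformation law gives the others, and the components at all other charts are \<open>0\<close>. Hence local
  representatives in an induced chart are well defined.\<close>

lemma tangent_chart_inj:
  assumes "smooth_manifold X \<C>" "c \<in> \<C>"
  shows "inj_on (snd (tangent_chart \<C> c)) (fst (tangent_chart \<C> c))"
proof (rule inj_onI)
  fix u v
  assume u: "u \<in> fst (tangent_chart \<C> c)" and v: "v \<in> fst (tangent_chart \<C> c)"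
    and eq: "snd (tangent_chart \<C> c) u = snd (tangent_chart \<C> c) v"
  obtain p \<xi> p' \<eta> where [simp]: "u = (p, \<xi>)" "v = (p', \<eta>)"
    by (metis surj_pair)
  have p: "p \<in> fst c" "p' \<in> fst c" and T: "\<xi> \<in> tangent_space \<C> p" "\<eta> \<in> tangent_space \<C> p'"
    using u v by (auto simp: tangent_chart_def tangent_bundle_def)
  have "p = p'" and c: "\<xi> c = \<eta> c"
    using eq p inj_onD[OF smooth_manifold_chart_inj[OF assms]] by (auto simp: tangent_chart_def)
  have "\<xi> c' = \<eta> c'" for c'
  proof (cases "c' \<in> \<C> \<and> p \<in> fst c'")
    case True
    then have "\<zeta> c' = frechet_derivative (transition c c') (at (snd c p)) (\<zeta> c)"
      if "\<zeta> \<in> tangent_space \<C> p" for \<zeta>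
      using that p \<open>c \<in> \<C>\<close> unfolding tangent_space_def by blast
    from this[of \<xi>] this[of \<eta>] show ?thesis
      using T c \<open>p = p'\<close> by simp
  next
    case False
    then have "\<xi> c' = 0" "\<eta> c' = 0"
      using T \<open>p = p'\<close> unfolding tangent_space_def by blast+
    then show ?thesis
      by simp
  qed
  with \<open>p = p'\<close> show "u = v"
    by auto
qed

text \<open>The transformation law is linear, as the derivative of a smooth transition map. A conical region
  is only closed under positive scaling; this covers the factor \<open>- 1\<close>.\<close>

lemma tangent_scale_in_tangent_bundle:
  assumes M: "smooth_manifold X \<C>" and u: "u \<in> tangent_bundle \<C>"
  shows "tangent_scale t u \<in> tangent_bundle \<C>"
proof -
  obtain p \<xi> where [simp]: "u = (p, \<xi>)"
    by (metis surj_pair)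
  have \<xi>: "\<xi> \<in> tangent_space \<C> p"
    using u by (simp add: tangent_bundle_def)
  have lin: "linear (frechet_derivative (transition c c') (at (snd c p)))"
    if "c \<in> \<C>" "c' \<in> \<C>" "p \<in> fst c" "p \<in> fst c'" for c c'
  proof -
    have "Ck_on 1 (chart_image c (fst c')) (transition c c')"
      using M that unfolding smooth_manifold_def smooth_on_def by blast
    then have "transition c c' differentiable at (snd c p)"
      using that by (auto simp: chart_image_def)
    then show ?thesis
      by (rule linear_frechet_derivative)
  qed
  have "(\<lambda>c. t *\<^sub>R \<xi> c) \<in> tangent_space \<C> p"
    unfolding tangent_space_def mem_Collect_eq
  proof (intro conjI allI ballI impI)
    show "t *\<^sub>R \<xi> c = 0" if "\<not> (c \<in> \<C> \<and> p \<in> fst c)" for c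
    proof -
      have "\<xi> c = 0"
        using \<xi> that unfolding tangent_space_def by blast
      then show ?thesis
        by simp
    qed
    fix c c' assume c: "c \<in> \<C>" "c' \<in> \<C>" "p \<in> fst c \<and> p \<in> fst c'"
    then have "\<xi> c' = frechet_derivative (transition c c') (at (snd c p)) (\<xi> c)"
      using \<xi> unfolding tangent_space_def by blast
    then show "t *\<^sub>R \<xi> c' = frechet_derivative (transition c c') (at (snd c p)) (t *\<^sub>R \<xi> c)"
      using linear_cmul[OF lin] c by simp
  qed
  then show ?thesis
    using u by (simp add: tangent_scale_def tangent_bundle_def)
qed

lemma tangent_chart_point:
  assumes "smooth_manifold X \<C>" "c \<in> \<C>" "B \<subseteq> tangent_bundle \<C>"
    and "z \<in> chart_image (tangent_chart \<C> c) B"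
  obtains u where "u \<in> B" "fst u \<in> fst c" "z = (snd c (fst u), snd u c)"
    "chart_inv (tangent_chart \<C> c) z = u"
proof -
  obtain u where u: "u \<in> B" "u \<in> fst (tangent_chart \<C> c)" "z = snd (tangent_chart \<C> c) u"
    using assms(4) by (auto simp: chart_image_def)
  then have "chart_inv (tangent_chart \<C> c) z = u"
    using inv_into_f_f[OF tangent_chart_inj[OF assms(1,2)]] by (simp add: chart_inv_def)
  with u show thesis
    by (intro that) (auto simp: tangent_chart_def)
qed

lemma local_rep_tangent_chart:
  assumes "smooth_manifold X \<C>" "c \<in> \<C>" "u \<in> tangent_bundle \<C>" "fst u \<in> fst c"
  shows "local_rep (tangent_chart \<C> c) f (snd c (fst u), snd u c) = f u"
proof -
  have "chart_inv (tangent_chart \<C> c) (snd (tangent_chart \<C> c) u) = u"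
    unfolding chart_inv_def using assms(3,4)
    by (intro inv_into_f_f[OF tangent_chart_inj[OF assms(1,2)]]) (auto simp: tangent_chart_def)
  then show ?thesis
    by (simp add: local_rep_def tangent_chart_def)
qed

lemma mem_chart_image_tangent_chart:
  assumes "smooth_manifold X \<C>" "c \<in> \<C>" "B \<subseteq> tangent_bundle \<C>"
    and "u \<in> tangent_bundle \<C>" "fst u \<in> fst c"
  shows "(snd c (fst u), snd u c) \<in> chart_image (tangent_chart \<C> c) B \<longleftrightarrow> u \<in> B"
proof
  assume "(snd c (fst u), snd u c) \<in> chart_image (tangent_chart \<C> c) B"
  then obtain v where "v \<in> B" "chart_inv (tangent_chart \<C> c) (snd c (fst u), snd u c) = v"
    by (rule tangent_chart_point[OF assms(1-3)])
  then show "u \<in> B"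
    using local_rep_tangent_chart[OF assms(1,2,4,5), of id] by (simp add: local_rep_def)
next
  assume "u \<in> B"
  then show "(snd c (fst u), snd u c) \<in> chart_image (tangent_chart \<C> c) B"
    using assms(4,5) by (force simp: chart_image_def tangent_chart_def)
qed

text \<open>The point with coordinates \<open>(x, t y)\<close> may lie outside the image of \<open>B\<close>, as for
  \<open>t = - 1\<close>, but it still represents a tangent vector, and the chart is injective on all of these.\<close>

lemma local_rep_tangent_scale:
  assumes "smooth_manifold X \<C>" "c \<in> \<C>" "B \<subseteq> tangent_bundle \<C>"
    and "(x, y) \<in> chart_image (tangent_chart \<C> c) B"
  shows "local_rep (tangent_chart \<C> c) f (x, t *\<^sub>R y) =
         local_rep (tangent_chart \<C> c) (\<lambda>u. f (tangent_scale t u)) (x, y)"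
proof -
  obtain u where u: "u \<in> B" "fst u \<in> fst c" "(x, y) = (snd c (fst u), snd u c)"
    using tangent_chart_point[OF assms] by blast
  then show ?thesis
    using local_rep_tangent_chart[OF assms(1,2) tangent_scale_in_tangent_bundle[OF assms(1)], of u t f]
      local_rep_tangent_chart[OF assms(1,2), of u "\<lambda>u. f (tangent_scale t u)"] assms(3)
    by (auto simp: tangent_scale_def)
qed

lemma chart_image_sym_region:
  assumes "smooth_manifold X \<C>" "c \<in> \<C>" "D \<subseteq> tangent_bundle \<C>"
  shows "chart_image (tangent_chart \<C> c) (sym_region D) =
    {z \<in> chart_image (tangent_chart \<C> c) D. reflect z \<in> chart_image (tangent_chart \<C> c) D}"
    (is "?L = ?R")
proof (rule set_eqI)
  fix z
  show "z \<in> ?L \<longleftrightarrow> z \<in> ?R"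
  proof (cases "z \<in> chart_image (tangent_chart \<C> c) D")
    case True
    then obtain u where u: "u \<in> D" "fst u \<in> fst c" "z = (snd c (fst u), snd u c)"
      using tangent_chart_point[OF assms] by blast
    have T: "u \<in> tangent_bundle \<C>" "sym_region D \<subseteq> tangent_bundle \<C>"
      using u assms(3) by (auto simp: sym_region_def)
    have "z \<in> ?L \<longleftrightarrow> tangent_scale (- 1) u \<in> D"
      using mem_chart_image_tangent_chart[OF assms(1,2) T(2,1) u(2)] u by (simp add: sym_region_def)
    moreover have "reflect z \<in> chart_image (tangent_chart \<C> c) D \<longleftrightarrow> tangent_scale (- 1) u \<in> D"
      using mem_chart_image_tangent_chart[OF assms
        tangent_scale_in_tangent_bundle[OF assms(1) T(1)], of "- 1"] u
      by (simp add: tangent_scale_def)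
    ultimately show ?thesis
      using True by simp
  next
    case False
    then show ?thesis
      by (auto simp: chart_image_def sym_region_def)
  qed
qed

lemma open_chart_image_conical:
  "conical_region \<C> D \<Longrightarrow> c \<in> \<C> \<Longrightarrow> open (chart_image (tangent_chart \<C> c) D)"
  by (auto simp: conical_region_def atlas_open_def tangent_atlas_def)

lemma open_reflect_region:
  assumes "open U"
  shows "open {z \<in> U. reflect z \<in> U}"
proof -
  have "continuous_on U reflect"
    by (rule linear_continuous_on[OF bounded_linear_reflect])
  then have "open (U \<inter> reflect -` U)"
    using assms by (intro continuous_open_preimage)
  then show ?thesis
    by (simp add: Int_def vimage_def)
qed

text \<open>The region is open because in a chart it is the intersection of an open set with its reflection,
  and conical because positive scaling commutes with the reflection.\<close>

lemma conical_region_sym_region: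
  fixes \<C> :: "('a, real^'n::finite) chart set"
  assumes M: "smooth_manifold X \<C>" and D: "conical_region \<C> D"
  shows "conical_region \<C> (sym_region D)"
proof -
  have T: "D \<subseteq> tangent_bundle \<C>"
    using D by (simp add: conical_region_def)
  have "open (chart_image (tangent_chart \<C> c) (sym_region D))" if "c \<in> \<C>" for c
    unfolding chart_image_sym_region[OF M that T]
    by (rule open_reflect_region[OF open_chart_image_conical[OF D that]])
  moreover have "sym_region D \<subseteq> (\<Union>c\<in>tangent_atlas \<C>. fst c)"
    using D by (auto simp: conical_region_def atlas_open_def sym_region_def)
  ultimately have "atlas_open (tangent_atlas \<C>) (sym_region D)"
    by (simp add: atlas_open_def tangent_atlas_def)
  moreover have "tangent_scale t u \<in> sym_region D" if "u \<in> sym_region D" "0 < t" for u t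
  proof -
    have "tangent_scale (- 1) (tangent_scale t u) = tangent_scale t (tangent_scale (- 1) u)"
      by (simp add: tangent_scale_def)
    then show ?thesis
      using that D unfolding sym_region_def conical_region_def by auto
  qed
  moreover have "sym_region D \<subseteq> tangent_bundle \<C>" "\<forall>u\<in>sym_region D. snd u \<noteq> (\<lambda>_. 0)"
    using D unfolding conical_region_def sym_region_def by blast+
  ultimately show ?thesis
    unfolding conical_region_def by blast
qed

lemma spray_coeff_smooth:
  fixes \<C> :: "('a, real^'n::finite) chart set"
  assumes "spray \<C> A \<G>" "c \<in> \<C>"
  shows "Ck_on k (chart_image (tangent_chart \<C> c) A) (\<lambda>z. spray_coeff \<C> \<G> c z $ r)"
proof -
  let ?c = "tangent_chart \<C> c"
  have A: "conical_region \<C> A" and "smooth_vector_field (tangent_atlas \<C>) A \<G>"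
    using assms(1) by (simp_all add: spray_def)
  then have V: "Ck_on k (chart_image ?c A) (local_rep ?c (\<lambda>u. \<G> u ?c))"
    using assms(2) by (simp add: smooth_vector_field_def tangent_atlas_def smooth_on_def)
  have L: "bounded_linear (\<lambda>w. ((- 1 / 2) *\<^sub>R snd w) $ r)"
    by (intro bounded_linear_compose[OF bounded_linear_vec_nth]
      bounded_linear_compose[OF bounded_linear_scaleR_right] bounded_linear_snd)
  have "Ck_on k (chart_image ?c A) (\<lambda>z. ((- 1 / 2) *\<^sub>R snd (local_rep ?c (\<lambda>u. \<G> u ?c) z)) $ r)"
    by (rule Ck_on_bounded_linear[OF open_chart_image_conical[OF A assms(2)] L V])
  then show ?thesis
    by (simp add: spray_coeff_def local_rep_def o_def)
qed

text \<open>Homogeneity on the conical region \<open>D\<close> gives Euler's identity in the coordinates.\<close>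

lemma funk_function_local:
  assumes M: "smooth_manifold X \<C>" and Q: "funk_function \<C> \<G> D Q" and c: "c \<in> \<C>"
  shows "funk_on (spray_coeff \<C> \<G> c) (chart_image (tangent_chart \<C> c) D)
    (local_rep (tangent_chart \<C> c) Q)"
  unfolding funk_on_def
proof (intro ballI conjI allI)
  let ?c = "tangent_chart \<C> c"
  fix z k assume z: "z \<in> chart_image ?c D"
  have D: "conical_region \<C> D" and T: "D \<subseteq> tangent_bundle \<C>" and h: "homogeneous1 D Q"
    using Q by (auto simp: funk_function_def conical_region_def)
  have "Ck_on 1 (chart_image ?c D) (local_rep ?c Q)"
    using Q c unfolding funk_function_def smooth_fun_def tangent_atlas_def smooth_on_def by blast
  then show d: "local_rep ?c Q differentiable at z"
    using z by simp
  show "hor (spray_coeff \<C> \<G> c) k (local_rep ?c Q) z =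
      local_rep ?c Q z * dy k (local_rep ?c Q) z"
    using Q c z by (simp add: funk_function_def)
  obtain x y where [simp]: "z = (x, y)"
    by (metis surj_pair)
  have "local_rep ?c Q (x, t *\<^sub>R y) = t * local_rep ?c Q (x, y)" if "0 < t" for t
  proof -
    obtain u where u: "u \<in> D" "chart_inv ?c (x, y) = u"
      by (rule tangent_chart_point[OF M c T]) (use z in simp)
    have "local_rep ?c Q (x, t *\<^sub>R y) = Q (tangent_scale t u)"
      using local_rep_tangent_scale[OF M c T, of x y Q t] z u(2) by (simp add: local_rep_def)
    also have "\<dots> = t * Q u"
      using h u(1) that unfolding homogeneous1_def by blast
    finally show ?thesis
      using u(2) by (simp add: local_rep_def)
  qed
  with d have "(\<Sum>i\<in>UNIV. dy i (local_rep ?c Q) (x, y) * y $ i) = local_rep ?c Q (x, y)"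
    unfolding \<open>z = (x, y)\<close> by (rule euler_identity)
  then show "(\<Sum>i\<in>UNIV. dy i (local_rep ?c Q) z * snd z $ i) = local_rep ?c Q z"
    by simp
qed

section \<open>Symmetrization\<close>

lemma local_rep_symmetrization:
  fixes \<C> :: "('a, real^'n::finite) chart set"
  assumes "smooth_manifold X \<C>" "c \<in> \<C>" "D \<subseteq> tangent_bundle \<C>"
    and "z \<in> chart_image (tangent_chart \<C> c) D"
  shows "local_rep (tangent_chart \<C> c) (symmetrization Q) z =
    1 / 2 * (local_rep (tangent_chart \<C> c) Q z + local_rep (tangent_chart \<C> c) Q (reflect z))"
  using local_rep_tangent_scale[OF assms(1-3), of "fst z" "snd z" Q "- 1"] assms(4)
  by (simp add: reflect_def local_rep_def symmetrization_def)

lemma smooth_fun_symmetrization: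
  fixes \<C> :: "('a, real^'n::finite) chart set"
  assumes M: "smooth_manifold X \<C>" and D: "conical_region \<C> D"
    and Q: "smooth_fun (tangent_atlas \<C>) D Q"
  shows "smooth_fun (tangent_atlas \<C>) (sym_region D) (symmetrization Q)"
  unfolding smooth_fun_def tangent_atlas_def smooth_on_def ball_simps
proof (intro ballI allI)
  fix c :: "('a, real^'n) chart" and k assume c: "c \<in> \<C>"
  let ?c = "tangent_chart \<C> c"
  let ?q = "local_rep ?c Q"
  let ?W = "chart_image ?c (sym_region D)"
  have T: "D \<subseteq> tangent_bundle \<C>"
    using D by (simp add: conical_region_def)
  note W = chart_image_sym_region[OF M c T]
  have openW: "open ?W"
    by (rule open_chart_image_conical[OF conical_region_sym_region[OF M D] c])
  have q: "Ck_on k (chart_image ?c D) ?q"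
    using Q c by (simp add: smooth_fun_def tangent_atlas_def smooth_on_def)
  have "Ck_on k ?W ?q"
    by (rule Ck_on_subset[OF q]) (auto simp: W)
  moreover have "Ck_on k ?W (\<lambda>z. ?q (reflect z))"
    by (rule Ck_on_precompose_bounded_linear[OF openW bounded_linear_reflect _ q]) (auto simp: W)
  ultimately have "Ck_on k ?W (\<lambda>z. 1 / 2 * (?q z + ?q (reflect z)))"
    by (intro Ck_on_bounded_linear[OF openW bounded_linear_mult_right] Ck_on_add[OF openW])
  then show "Ck_on k ?W (local_rep ?c (symmetrization Q))"
    by (rule Ck_on_cong_open[OF openW, rotated])
      (simp add: W local_rep_symmetrization[OF M c T])
qed

lemma homogeneous1_symmetrization:
  assumes "homogeneous1 D Q"
  shows "homogeneous1 (sym_region D) (symmetrization Q)"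
  unfolding homogeneous1_def
proof (intro ballI allI impI)
  fix u :: "('a, 'b) tangent" and t :: real assume "u \<in> sym_region D" "0 < t"
  moreover have "tangent_scale (- 1) (tangent_scale t u) = tangent_scale t (tangent_scale (- 1) u)"
    by (simp add: tangent_scale_def)
  ultimately show "symmetrization Q (tangent_scale t u) = t * symmetrization Q u"
    using assms by (simp add: symmetrization_def homogeneous1_def sym_region_def algebra_simps)
qed

section \<open>The curvature identities\<close>

theorem lemma3p7:
  fixes X :: "'a topology"
    and \<C> :: "('a, real^'n::finite) chart set"
    and A D :: "('a, real^'n) tangent set"
    and \<G> :: "('a, real^'n) bundle_field"
    and Q :: "('a, real^'n) tangent \<Rightarrow> real"
  assumes "smooth_manifold X \<C>"
    and "spray \<C> A \<G>"
    and "D \<subseteq> A"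
    and "funk_function \<C> \<G> D Q"
  shows
    "(\<forall>c\<in>\<C>. \<forall>z\<in>chart_image (tangent_chart \<C> c) D.
        let G = spray_coeff \<C> \<G> c;
            q = local_rep (tangent_chart \<C> c) Q;
            P = (\<lambda>w. hor0 G q w / (2 * q w))
        in q z \<noteq> 0 \<longrightarrow>
             P z = (1 / 2) * q z \<and>
             ((P z)\<^sup>2 - hor0 G P z) / (q z)\<^sup>2 = - (1 / 4)) \<and>
     (strictly_reversible \<C> A \<G> \<longrightarrow>
        hamel_function \<C> \<G> (sym_region D) (symmetrization Q) \<and>
        (\<forall>c\<in>\<C>. \<forall>(x, y)\<in>chart_image (tangent_chart \<C> c) (sym_region D).
           let G = spray_coeff \<C> \<G> c;
               q = local_rep (tangent_chart \<C> c) Q;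
               qt = local_rep (tangent_chart \<C> c) (symmetrization Q);
               Pt = (\<lambda>w. hor0 G qt w / (2 * qt w))
           in qt (x, y) \<noteq> 0 \<longrightarrow>
                Pt (x, y) = (1 / 2) * (q (x, y) - q (x, - y)) \<and>
                ((Pt (x, y))\<^sup>2 - hor0 G Pt (x, y)) / (qt (x, y))\<^sup>2 = - 1))"
proof -
  note M = assms(1)
  have D: "conical_region \<C> D" and T: "D \<subseteq> tangent_bundle \<C>" and hom: "homogeneous1 D Q"
    and smooth: "smooth_fun (tangent_atlas \<C>) D Q"
    using assms(4) by (auto simp: funk_function_def conical_region_def)
  define q where "q c = local_rep (tangent_chart \<C> c) Q" for c
  define qt where "qt c = local_rep (tangent_chart \<C> c) (symmetrization Q)" for c
  define G where "G c = spray_coeff \<C> \<G> c" for c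
  define U where "U c = chart_image (tangent_chart \<C> c) D" for c
  define W where "W c = chart_image (tangent_chart \<C> c) (sym_region D)" for c
  have W: "W c = {z \<in> U c. reflect z \<in> U c}" if "c \<in> \<C>" for c
    unfolding W_def U_def by (rule chart_image_sym_region[OF M that T])
  have openU: "open (U c)" and openW: "open (W c)" if "c \<in> \<C>" for c
    using open_chart_image_conical[OF _ that] D conical_region_sym_region[OF M D]
    by (simp_all add: U_def W_def)
  have funk: "funk_on (G c) (U c) (q c)" if "c \<in> \<C>" for c
    unfolding G_def U_def q_def by (rule funk_function_local[OF M assms(4) that])
  have "hor0 (G c) (q c) z / (2 * q c z) = 1 / 2 * q c z \<and>
      ((hor0 (G c) (q c) z / (2 * q c z))\<^sup>2 - hor0 (G c) (\<lambda>w. hor0 (G c) (q c) w / (2 * q c w)) z)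
        / (q c z)\<^sup>2 = - (1 / 4)"
    if "c \<in> \<C>" "z \<in> U c" "q c z \<noteq> 0" for c z
  proof -
    \<comment> \<open>The zero function is Funk, so \<open>q = 1 (q - 0)\<close> is a difference of Funk functions.\<close>
    note * = scaled_difference_funk_curvature[OF openU[OF that(1)] that(2) funk[OF that(1)]
        funk_on_zero, of "q c" 1, simplified, OF that(3)]
    show ?thesis
      using * \<open>q c z \<noteq> 0\<close> by (simp add: power_divide)
  qed
  moreover have "hamel_function \<C> \<G> (sym_region D) (symmetrization Q) \<and>
      (\<forall>c\<in>\<C>. \<forall>z\<in>W c. qt c z \<noteq> 0 \<longrightarrow>
        hor0 (G c) (qt c) z / (2 * qt c z) = 1 / 2 * (q c z - q c (reflect z)) \<and>
        ((hor0 (G c) (qt c) z / (2 * qt c z))\<^sup>2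
          - hor0 (G c) (\<lambda>w. hor0 (G c) (qt c) w / (2 * qt c w)) z) / (qt c z)\<^sup>2 = - 1)"
    if rev: "strictly_reversible \<C> A \<G>"
  proof -
    \<comment> \<open>The second Funk function, whose difference with \<open>q\<close> is twice the symmetrization\<close>
    define p where "p c = (\<lambda>z. - q c (reflect z))" for c
    have UA: "U c \<subseteq> chart_image (tangent_chart \<C> c) A" for c
      using assms(3) by (auto simp: U_def chart_image_def)
    have G2: "Ck_on k (W c) (\<lambda>z. G c z $ r)" if "c \<in> \<C>" for c k r
      unfolding G_def using W[OF that] UA[of c]
      by (intro Ck_on_subset[OF spray_coeff_smooth[OF assms(2) that]]) auto
    have funkW: "funk_on (G c) (W c) (q c)" if "c \<in> \<C>" for c
      using funk[OF that] W[OF that] by (simp add: funk_on_def)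
    have funkp: "funk_on (G c) (W c) (p c)" if c: "c \<in> \<C>" for c
      unfolding p_def
    proof (rule funk_on_reflect[OF openW[OF c] _ funkW[OF c]])
      show "reflect w \<in> W c" if "w \<in> W c" for w
        using that by (simp add: W[OF c] reflect_def)
      show "(\<lambda>w. G c w $ r) differentiable at w" if "w \<in> W c" for w r
        using G2[OF c, of 1 r] that by simp
      show "G c (reflect w) = G c w" if "w \<in> W c" for w
        using rev c that UA[of c] unfolding strictly_reversible_def G_def W[OF c]
        by (cases w) force
    qed
    have qt: "qt c w = 1 / 2 * (q c w - p c w)" if "c \<in> \<C>" "w \<in> W c" for c w
      using local_rep_symmetrization[OF M that(1) T] that W[OF that(1)]
      by (simp add: qt_def q_def p_def U_def)
    have smt: "smooth_fun (tangent_atlas \<C>) (sym_region D) (symmetrization Q)"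
      by (rule smooth_fun_symmetrization[OF M D smooth])
    have qt2: "Ck_on 2 (W c) (qt c)" if "c \<in> \<C>" for c
      using smt that by (simp add: smooth_fun_def tangent_atlas_def smooth_on_def W_def qt_def)
    have "hor (G c) k (qt c) z = ver_hor0 (G c) k (qt c) z" if "c \<in> \<C>" "z \<in> W c" for c z k
      by (rule scaled_difference_funk_is_hamel[OF openW[OF that(1)] that(2) funkW[OF that(1)]
        funkp[OF that(1)] qt[OF that(1)] qt2[OF that(1)] G2[OF that(1)]])
    then have "hamel_function \<C> \<G> (sym_region D) (symmetrization Q)"
      using smt conical_region_sym_region[OF M D] homogeneous1_symmetrization[OF hom]
      by (simp add: hamel_function_def G_def qt_def W_def)
    moreover have "hor0 (G c) (qt c) z / (2 * qt c z) = 1 / 2 * (q c z - q c (reflect z)) \<and>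
        ((hor0 (G c) (qt c) z / (2 * qt c z))\<^sup>2
          - hor0 (G c) (\<lambda>w. hor0 (G c) (qt c) w / (2 * qt c w)) z) / (qt c z)\<^sup>2 = - 1"
      if "c \<in> \<C>" "z \<in> W c" "qt c z \<noteq> 0" for c z
    proof -
      note * = scaled_difference_funk_curvature[OF openW[OF that(1)] that(2) funkW[OF that(1)]
        funkp[OF that(1)] qt[OF that(1)] that(3)]
      have "((q c z - p c z) / 2)\<^sup>2 = (qt c z)\<^sup>2"
        by (simp add: qt[OF that(1,2)])
      then show ?thesis
        using * \<open>qt c z \<noteq> 0\<close> by (simp add: p_def)
    qed
    ultimately show ?thesis
      by blast
  qed
  ultimately show ?thesis
    unfolding Let_def G_def q_def qt_def U_def W_def by (auto simp: case_prod_beta reflect_def)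
qed

end
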